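(* Let $L \in K[\partial_t,\partial_{x_1},\dots,\partial_{x_n}]$, and suppose that for some $k\ge1$ there are nonzero operators $A_1, A_2,\dots, A_k$, $M = M_1, M_2, \dots, M_k \in K[\partial_t,\partial_{x_1},\dots,\partial_{x_n}]$ and a nonzero $f = M_{k+1} \in K$ so that $$M_{i-1} = A_i M_i + M_{i+1},\qquad 1 \leq i \leq k,$$ where $M_0=L$. Then there exists a Darboux transformation $$(M_1,N)\colon L \rightarrow L_1$$ for the operator $L$, defined as follows. Define $N_{k+1} = M_{k+1} = f$ and $N_{k} = fM_kf^{-1}$, and define $N_i$ for $0 \leq i \leq k-1$ by downward recursion using $N_i = N_{i+1}A_{i+1} + N_{i+2}$. Finally let $N = N_1$ and $L_1 = N_0$. Then $M$ and $N$ have the same principal symbol, and the intertwining relation $NL = L_1M$ holds. The corresponding Darboux transformation is not obtained from a factorization, nor a multiple of a Darboux transformation of Wronskian type, and if $k > 1$ it is not of Type I.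
   Context: $K$ is a differential field of characteristic zero with commuting derivations $\partial_t,\partial_{x_1},\dots,\partial_{x_n}$, and $K[\partial_t,\partial_{x_1},\dots,\partial_{x_n}]$ is the ring of linear partial differential operators over $K$. Standing convention: either $K$ is differentially closed, or $K$ is assumed to contain the solutions of the partial differential equations encountered. Elements of $K$ are called functions. $\ker L$ is the set of $\phi\in K$ with $L[\phi]=0$. $\sigma(L)$ denotes the principal symbol of $L$. A Darboux transformation $(M,N)\colon L\to L_1$, where $\sigma(L)=\sigma(L_1)$, is a pair of operators $(M,N)$ satisfying the intertwining relation $NL=L_1M$. A Darboux transformation obtained from a factorization is one of the form $(M,N)\colon CM\to NC$, where $L=CM$ with $C,M\in K[\partial_t,\partial_{x_1},\dots,\partial_{x_n}]\setminus K$ and $N$ is any operator with $\sigma(N)=\sigma(M)$. A Darboux transformation $(M,N)\colon L\to L_1$ is of Type I if there are an operator $C$ and a nonzero function $f\in K$ with $L=CM+f$, $N=M^{1/f}:=fM(1/f)$, and $L_1=M^{1/f}C+f$. A Darboux transformation $(M,N)\colon L\to L_1$ is of Wronskian type if, after a change of variables, $M$ can be put in the form $M(f)=\dfrac{W(f_1,\dots,f_m,f)}{W(f_1,\dots,f_m)}$, where $W$ denotes the Wronskian determinant with respect to one of the variables, and $f_1,\dots,f_m\in K$ ($m\ge1$) are linearly independent elements of $\ker L$. It is a multiple of Wronskian type if $M$ is the result of multiplying an operator of that form on the left by a function in $K$.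
   Formalization: For the last claim (k > 1, not of Type I) it is assumed in addition that A_2,…,A_k and M_k are not in K; otherwise it fails, e.g. k=2, f=M_2=1, A_1=A_2=∂, M_1=∂+1, L=∂(∂+1)+1 is of Type I. *)

theory Defs
  imports
    "HOL-Library.Poly_Mapping"
    "HOL-Library.Multiset"
    "Jordan_Normal_Form.Determinant"
begin

text \<open>
  The index type \<open>'v\<close> is the finite, nonempty set of independent variables \<open>t, x\<^sub>1, \<dots>, x\<^sub>n\<close>;
  \<open>D v\<close> is the derivation of the field \<open>'a\<close> belonging to the variable \<open>v\<close>.
\<close>

locale differential_field =
  fixes D :: "'v::finite \<Rightarrow> 'a::field_char_0 \<Rightarrow> 'a"
  assumes deriv_add: "D v (a + b) = D v a + D v b"
    and deriv_mult: "D v (a * b) = D v a * b + a * D v b"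
    and deriv_commute: "D u (D v a) = D v (D u a)"

text \<open>
  A monomial \<open>\<partial>\<^sup>\<alpha>\<close> is encoded by the multiset \<open>\<alpha>\<close> of its variables, so \<open>size \<alpha>\<close> is its
  order, and an operator \<open>\<Sum>\<^sub>\<alpha> a\<^sub>\<alpha> \<partial>\<^sup>\<alpha>\<close> (coefficients on the left) by the finitely supported
  map \<open>\<alpha> \<mapsto> a\<^sub>\<alpha>\<close>.  On this type \<open>+\<close> and \<open>0\<close> are those of the operator ring, but the library's
  multiplication \<open>*\<close> is that of commutative polynomials, i.e. of symbols;
  composition of operators is \<open>op_comp\<close> below.
\<close>

type_synonym ('v, 'a) diffop = "'v multiset \<Rightarrow>\<^sub>0 'a"

definition func :: "'a::zero \<Rightarrow> ('v, 'a) diffop" where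
  "func f = Poly_Mapping.single {#} f"

abbreviation func_ops :: "('v, 'a::zero) diffop set" where
  "func_ops \<equiv> range func"

text \<open>\<open>\<partial>\<^sub>v \<circ> (\<Sum>\<^sub>\<beta> b\<^sub>\<beta> \<partial>\<^sup>\<beta>) = \<Sum>\<^sub>\<beta> (\<partial>\<^sub>v(b\<^sub>\<beta>) \<partial>\<^sup>\<beta> + b\<^sub>\<beta> \<partial>\<^sub>v\<partial>\<^sup>\<beta>)\<close>\<close>

definition deriv_comp ::
    "('v \<Rightarrow> 'a \<Rightarrow> 'a) \<Rightarrow> 'v \<Rightarrow> ('v, 'a::field) diffop \<Rightarrow> ('v, 'a) diffop" where
  "deriv_comp D v B =
     (\<Sum>\<beta>\<in>Poly_Mapping.keys B. Poly_Mapping.single \<beta> (D v (Poly_Mapping.lookup B \<beta>)) +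
        Poly_Mapping.single (add_mset v \<beta>) (Poly_Mapping.lookup B \<beta>))"

text \<open>
  \<open>(\<Sum>\<^sub>\<alpha> a\<^sub>\<alpha> \<partial>\<^sup>\<alpha>) \<circ> B = \<Sum>\<^sub>\<alpha> a\<^sub>\<alpha> (\<partial>\<^sup>\<alpha> \<circ> B)\<close>.  Here, and in \<open>op_apply\<close>, \<open>fold_mset\<close> iterates
  over the variables of \<open>\<alpha>\<close>; it is meaningful because the maps iterated commute when
  \<open>differential_field D\<close> holds.
\<close>

definition op_comp ::
    "('v, 'a) diffop \<Rightarrow> ('v \<Rightarrow> 'a \<Rightarrow> 'a) \<Rightarrow> ('v, 'a::field) diffop \<Rightarrow> ('v, 'a) diffop"
    (\<open>(_ \<star>\<^bsub>_\<^esub> _)\<close> [70, 0, 71] 70) where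
  "A \<star>\<^bsub>D\<^esub> B =
     (\<Sum>\<alpha>\<in>Poly_Mapping.keys A. Poly_Mapping.map ((*) (Poly_Mapping.lookup A \<alpha>)) (fold_mset (deriv_comp D) B \<alpha>))"

definition op_apply :: "('v \<Rightarrow> 'a \<Rightarrow> 'a) \<Rightarrow> ('v, 'a::field) diffop \<Rightarrow> 'a \<Rightarrow> 'a" where
  "op_apply D A \<phi> = (\<Sum>\<alpha>\<in>Poly_Mapping.keys A. Poly_Mapping.lookup A \<alpha> * fold_mset D \<phi> \<alpha>)"

definition op_ker :: "('v \<Rightarrow> 'a \<Rightarrow> 'a) \<Rightarrow> ('v, 'a::field) diffop \<Rightarrow> 'a set" where
  "op_ker D A = {\<phi>. op_apply D A \<phi> = 0}"

definition op_order :: "('v, 'a::zero) diffop \<Rightarrow> nat" where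
  "op_order A = Max (insert 0 (size ` Poly_Mapping.keys A))"

definition symbol :: "('v, 'a::field) diffop \<Rightarrow> ('v, 'a) diffop" where
  "symbol A = (\<Sum>\<alpha>\<in>{\<alpha>\<in>Poly_Mapping.keys A. size \<alpha> = op_order A}. Poly_Mapping.single \<alpha> (Poly_Mapping.lookup A \<alpha>))"

text \<open>The conjugate \<open>M\<^sup>1\<^sup>/\<^sup>f = f M (1/f)\<close>.\<close>

definition conj_inv ::
    "('v \<Rightarrow> 'a \<Rightarrow> 'a) \<Rightarrow> ('v, 'a::field) diffop \<Rightarrow> 'a \<Rightarrow> ('v, 'a) diffop" where
  "conj_inv D M f = func f \<star>\<^bsub>D\<^esub> M \<star>\<^bsub>D\<^esub> func (1 / f)"

text \<open>In the following predicates the arguments \<open>L L1 M N\<close> stand for \<open>(M, N) : L \<rightarrow> L1\<close>.\<close>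

definition darboux ::
    "('v \<Rightarrow> 'a \<Rightarrow> 'a) \<Rightarrow> ('v, 'a::field) diffop \<Rightarrow> ('v, 'a) diffop \<Rightarrow>
     ('v, 'a) diffop \<Rightarrow> ('v, 'a) diffop \<Rightarrow> bool" where
  "darboux D L L1 M N \<longleftrightarrow> symbol L = symbol L1 \<and> N \<star>\<^bsub>D\<^esub> L = L1 \<star>\<^bsub>D\<^esub> M"

definition from_factorization ::
    "('v \<Rightarrow> 'a \<Rightarrow> 'a) \<Rightarrow> ('v, 'a::field) diffop \<Rightarrow> ('v, 'a) diffop \<Rightarrow>
     ('v, 'a) diffop \<Rightarrow> ('v, 'a) diffop \<Rightarrow> bool" where
  "from_factorization D L L1 M N \<longleftrightarrow> darboux D L L1 M N \<and>
     (\<exists>C. C \<notin> func_ops \<and> M \<notin> func_ops \<and> L = C \<star>\<^bsub>D\<^esub> M \<and> L1 = N \<star>\<^bsub>D\<^esub> C \<and> symbol N = symbol M)"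

definition type_I ::
    "('v \<Rightarrow> 'a \<Rightarrow> 'a) \<Rightarrow> ('v, 'a::field) diffop \<Rightarrow> ('v, 'a) diffop \<Rightarrow>
     ('v, 'a) diffop \<Rightarrow> ('v, 'a) diffop \<Rightarrow> bool" where
  "type_I D L L1 M N \<longleftrightarrow> darboux D L L1 M N \<and>
     (\<exists>C f. f \<noteq> 0 \<and> L = C \<star>\<^bsub>D\<^esub> M + func f \<and> N = conj_inv D M f \<and>
        L1 = conj_inv D M f \<star>\<^bsub>D\<^esub> C + func f)"

definition constants :: "('v \<Rightarrow> 'a \<Rightarrow> 'a::field) \<Rightarrow> 'a set" where
  "constants D = {c. \<forall>v. D v c = 0}"

definition lin_indep :: "('v \<Rightarrow> 'a \<Rightarrow> 'a::field) \<Rightarrow> 'a list \<Rightarrow> bool" where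
  "lin_indep D fs \<longleftrightarrow>
     (\<forall>c. (\<forall>i<length fs. c i \<in> constants D) \<and> (\<Sum>i<length fs. c i * fs ! i) = 0 \<longrightarrow>
        (\<forall>i<length fs. c i = 0))"

definition wronskian :: "('a \<Rightarrow> 'a) \<Rightarrow> 'a::field list \<Rightarrow> 'a" where
  "wronskian d fs = det (mat (length fs) (length fs) (\<lambda>(i, j). (d ^^ i) (fs ! j)))"

text \<open>
  In new variables the derivations become \<open>\<partial>'\<^sub>u = \<Sum>\<^sub>w P\<^sub>u\<^sub>w \<partial>\<^sub>w\<close>, with \<open>P\<close> an invertible matrix over
  the field, and they commute again.  As \<open>K\<close> is an abstract differential field, no coordinate
  functions are required to exist in it.
\<close>

definition change_of_variables ::
    "('v::finite \<Rightarrow> 'a \<Rightarrow> 'a) \<Rightarrow> ('v \<Rightarrow> 'a \<Rightarrow> 'a::field_char_0) \<Rightarrow> bool" where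
  "change_of_variables D E \<longleftrightarrow> differential_field E \<and>
     (\<exists>P Q. (\<forall>u \<phi>. E u \<phi> = (\<Sum>w\<in>UNIV. P u w * D w \<phi>)) \<and>
        (\<forall>u v. (\<Sum>w\<in>UNIV. P u w * Q w v) = (if u = v then 1 else 0)) \<and>
        (\<forall>u v. (\<Sum>w\<in>UNIV. Q u w * P w v) = (if u = v then 1 else 0)))"

text \<open>
  The quotient of Wronskians makes sense only if \<open>W(f\<^sub>1,\<dots>,f\<^sub>m) \<noteq> 0\<close>.  This is required separately:
  linear independence over the constants of all derivations does not imply it.
\<close>

definition wronskian_form ::
    "('v::finite \<Rightarrow> 'a \<Rightarrow> 'a) \<Rightarrow> ('v, 'a::field_char_0) diffop \<Rightarrow> ('v, 'a) diffop \<Rightarrow> bool" where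
  "wronskian_form D L M \<longleftrightarrow>
     (\<exists>E v fs. change_of_variables D E \<and> fs \<noteq> [] \<and> set fs \<subseteq> op_ker D L \<and> lin_indep D fs \<and>
        wronskian (E v) fs \<noteq> 0 \<and>
        (\<forall>\<phi>. op_apply D M \<phi> = wronskian (E v) (fs @ [\<phi>]) / wronskian (E v) fs))"

definition multiple_of_wronskian_type ::
    "('v::finite \<Rightarrow> 'a \<Rightarrow> 'a) \<Rightarrow> ('v, 'a::field_char_0) diffop \<Rightarrow> ('v, 'a) diffop \<Rightarrow>
     ('v, 'a) diffop \<Rightarrow> ('v, 'a) diffop \<Rightarrow> bool" where
  "multiple_of_wronskian_type D L L1 M N \<longleftrightarrow> darboux D L L1 M N \<and>
     (\<exists>g M'. wronskian_form D L M' \<and> M = func g \<star>\<^bsub>D\<^esub> M')"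

end

theory Submission
  imports Defs
begin

text \<open>
  The chain \<open>M\<^sub>i\<^sub>-\<^sub>1 = A\<^sub>i M\<^sub>i + M\<^sub>i\<^sub>+\<^sub>1\<close> is a Euclidean algorithm for \<open>L\<close> and \<open>M\<^sub>1\<close> that ends in the unit
  \<open>f\<close>, and the \<open>N\<^sub>i\<close> run the mirror-image chain, with the same quotients on the other side.

  Intertwining.  The two chains satisfy \<open>N\<^sub>i\<^sub>+\<^sub>1 M\<^sub>i = N\<^sub>i M\<^sub>i\<^sub>+\<^sub>1\<close>.  For \<open>i = k\<close> this reads
  \<open>f M\<^sub>k = (f M\<^sub>k f\<^sup>-\<^sup>1) f\<close>, which is why \<open>N\<^sub>k\<close> is that conjugate, and from \<open>i + 1\<close> to \<open>i\<close> it is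
  passed on by expanding \<open>M\<^sub>i\<close> on the left and \<open>N\<^sub>i\<close> on the right.  For \<open>i = 0\<close> it is the
  intertwining relation.

  Symbols.  The symbol is multiplicative and takes values in a polynomial ring, which has no zero
  divisors.  So the same identities, read on symbols, allow cancellation and carry
  \<open>\<sigma>(N\<^sub>i) = \<sigma>(M\<^sub>i)\<close> down from \<open>i = k + 1\<close> to \<open>i = 0\<close>.  Reading symbols off these products,
  and not off the recursions, avoids the question whether leading terms cancel in
  \<open>A\<^sub>i M\<^sub>i + M\<^sub>i\<^sub>+\<^sub>1\<close>.

  Excluded types.  A left ideal containing \<open>L\<close> and \<open>M\<^sub>1\<close> contains every \<open>M\<^sub>i\<close>, hence \<open>f\<close>.  If
  \<open>L = C M\<^sub>1\<close>, take the left multiples of \<open>M\<^sub>1\<close>: then \<open>f\<close> is one of them and \<open>M\<^sub>1\<close> has order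
  zero.  If \<open>M\<^sub>1\<close> is a multiple of Wronskian type, it kills some nonzero \<open>\<phi>\<close> in the kernel
  of \<open>L\<close>; take the operators killing \<open>\<phi>\<close>: then \<open>f \<phi> = 0\<close>.  For Type I, the orders of
  \<open>M\<^sub>1, M\<^sub>2, \<dots>, M\<^sub>k\<close> decrease strictly and stay positive if \<open>A\<^sub>2, \<dots>, A\<^sub>k\<close> and \<open>M\<^sub>k\<close> are
  not functions; but \<open>L = C M\<^sub>1 + h\<close> gives \<open>M\<^sub>2 = (C - A\<^sub>1) M\<^sub>1 + h\<close>, whose order is either zero or
  at least that of \<open>M\<^sub>1\<close>.
\<close>

section \<open>The ring of differential operators\<close>

lemma sum_keys_single:
  fixes P :: "'v \<Rightarrow>\<^sub>0 'a::comm_monoid_add"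
  shows "(\<Sum>\<alpha>\<in>Poly_Mapping.keys P. Poly_Mapping.single \<alpha> (Poly_Mapping.lookup P \<alpha>)) = P"
  by (rule poly_mapping_eqI)
    (auto simp: lookup_sum lookup_single when_def sum.delta in_keys_iff)

text \<open>
  Composition and application are additive in the left operator, so identities about them
  reduce to a single term \<open>c \<partial>\<^sup>\<alpha>\<close>.
\<close>

lemma diffop_induct [case_names single add]:
  fixes A :: "('v, 'a::field) diffop"
  assumes single: "\<And>\<alpha> c. P (Poly_Mapping.single \<alpha> c)"
    and add: "\<And>A B. P A \<Longrightarrow> P B \<Longrightarrow> P (A + B)"
  shows "P A"
proof -
  have zero: "P 0"
    using single[of undefined 0] by simp
  have "P (\<Sum>\<alpha>\<in>S. Poly_Mapping.single \<alpha> (Poly_Mapping.lookup A \<alpha>))" if "finite S" for S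
    using that by (induction S rule: finite_induct) (auto intro: zero single add)
  from this[of "Poly_Mapping.keys A"] show ?thesis
    by (simp add: sum_keys_single)
qed

lemma func_0 [simp]: "func 0 = 0"
  by (simp add: func_def)

lemma func_eq_0_iff [simp]: "func c = 0 \<longleftrightarrow> c = 0"
  by (metis func_def func_0 lookup_single_eq lookup_zero)

text \<open>
  Multiplying all coefficients by \<open>c\<close> is a multiplication in the commutative ring of symbols
  (\<open>c\<close> has constant symbol).  This makes the ring laws of symbols available for the scalar action
  on operators.
\<close>

lemma map_scale_eq_func_mult: "Poly_Mapping.map ((*) c) P = func c * P"
  by (simp add: mult_map_scale_conv_mult func_def zero_multiset_def)

lemma func_mult_func: "func (a * b) = func a * func b"
  by (simp add: func_def mult_single flip: zero_multiset_def)

lemma func_add: "func (a + b) = func a + func b"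
  by (simp add: func_def single_add)

lemma func_one: "func 1 = 1"
  by (simp add: func_def flip: zero_multiset_def)

lemma func_mult_single: "func a * Poly_Mapping.single \<alpha> b = Poly_Mapping.single \<alpha> (a * b)"
  by (simp add: func_def mult_single)

lemma op_comp_alt:
  "A \<star>\<^bsub>D\<^esub> B = (\<Sum>\<alpha>\<in>Poly_Mapping.keys A. func (Poly_Mapping.lookup A \<alpha>) * fold_mset (deriv_comp D) B \<alpha>)"
  by (simp add: op_comp_def map_scale_eq_func_mult)

lemma op_comp_single: "Poly_Mapping.single \<alpha> c \<star>\<^bsub>D\<^esub> B = func c * fold_mset (deriv_comp D) B \<alpha>"
  by (cases "c = 0") (auto simp: op_comp_alt)

lemma func_op_comp: "func c \<star>\<^bsub>D\<^esub> B = func c * B"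
  using op_comp_single[of "{#}" c D B] by (simp add: func_def)

lemma op_comp_add_left: "(A + B) \<star>\<^bsub>D\<^esub> C = A \<star>\<^bsub>D\<^esub> C + B \<star>\<^bsub>D\<^esub> C"
  unfolding op_comp_alt
  by (rule setsum_keys_plus_distrib) (simp_all add: func_add distrib_right)

lemma zero_op_comp [simp]: "0 \<star>\<^bsub>D\<^esub> B = 0"
  by (simp add: op_comp_def)

lemma op_comp_diff_left: "(A - B) \<star>\<^bsub>D\<^esub> C = A \<star>\<^bsub>D\<^esub> C - B \<star>\<^bsub>D\<^esub> C"
  using op_comp_add_left[of "A - B" B D C] by (simp add: algebra_simps)

lemma func_mult_op_comp: "(func c * A) \<star>\<^bsub>D\<^esub> B = func c * (A \<star>\<^bsub>D\<^esub> B)"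
proof (induction A rule: diffop_induct)
  case (single \<alpha> b)
  show ?case
    by (simp add: func_mult_single op_comp_single func_mult_func mult.assoc)
next
  case (add A A')
  then show ?case
    by (simp add: op_comp_add_left algebra_simps)
qed

lemma op_apply_single: "op_apply D (Poly_Mapping.single \<alpha> c) \<phi> = c * fold_mset D \<phi> \<alpha>"
  by (cases "c = 0") (auto simp: op_apply_def)

lemma op_apply_func: "op_apply D (func c) \<phi> = c * \<phi>"
  by (simp add: func_def op_apply_single)

lemma op_apply_add: "op_apply D (A + B) \<phi> = op_apply D A \<phi> + op_apply D B \<phi>"
  unfolding op_apply_def
  by (rule setsum_keys_plus_distrib) (simp_all add: algebra_simps)

lemma op_apply_diff: "op_apply D (A - B) \<phi> = op_apply D A \<phi> - op_apply D B \<phi>"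
  using op_apply_add[of D "A - B" B \<phi>] by (simp add: algebra_simps)

lemma op_apply_func_mult: "op_apply D (func c * A) \<phi> = c * op_apply D A \<phi>"
  by (induction A rule: diffop_induct)
    (simp_all add: func_mult_single op_apply_single op_apply_add algebra_simps)

context differential_field
begin

lemma deriv_zero [simp]: "D v 0 = 0"
  using deriv_add[of v 0 0] by simp

lemma deriv_one [simp]: "D v 1 = 0"
  using deriv_mult[of v 1 1] by simp

lemma deriv_comp_single:
  "deriv_comp D v (Poly_Mapping.single \<beta> c) =
     Poly_Mapping.single \<beta> (D v c) + Poly_Mapping.single (add_mset v \<beta>) c"
  by (cases "c = 0") (auto simp: deriv_comp_def)

lemma deriv_comp_add: "deriv_comp D v (A + B) = deriv_comp D v A + deriv_comp D v B"
  unfolding deriv_comp_def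
  by (rule setsum_keys_plus_distrib) (simp_all add: single_add deriv_add algebra_simps)

lemma deriv_comp_zero [simp]: "deriv_comp D v 0 = 0"
  by (simp add: deriv_comp_def)

lemma deriv_comp_func_mult:
  "deriv_comp D v (func c * A) = func (D v c) * A + func c * deriv_comp D v A"
  by (induction A rule: diffop_induct)
    (simp_all add: func_mult_single deriv_comp_single deriv_comp_add deriv_mult single_add distrib_left add_ac)

lemma deriv_comp_commute: "deriv_comp D u (deriv_comp D v A) = deriv_comp D v (deriv_comp D u A)"
  by (induction A rule: diffop_induct)
    (simp_all add: deriv_comp_single deriv_comp_add deriv_commute[of u v] add_mset_commute[of u v] add_ac)

lemma fold_deriv_comp_add_mset [simp]:
  "fold_mset (deriv_comp D) B (add_mset v \<alpha>) = deriv_comp D v (fold_mset (deriv_comp D) B \<alpha>)"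
proof -
  interpret comp_fun_commute "deriv_comp D"
    by standard (auto simp: fun_eq_iff deriv_comp_commute)
  show ?thesis
    by (rule fold_mset_add_mset)
qed

lemma fold_deriv_add_mset [simp]: "fold_mset D \<phi> (add_mset v \<alpha>) = D v (fold_mset D \<phi> \<alpha>)"
proof -
  interpret comp_fun_commute D
    by standard (auto simp: fun_eq_iff deriv_commute)
  show ?thesis
    by (rule fold_mset_add_mset)
qed

lemma fold_deriv_comp_add:
  "fold_mset (deriv_comp D) (A + B) \<alpha> = fold_mset (deriv_comp D) A \<alpha> + fold_mset (deriv_comp D) B \<alpha>"
  by (induction \<alpha>) (simp_all add: deriv_comp_add)

lemma op_comp_add_right: "A \<star>\<^bsub>D\<^esub> (B + C) = A \<star>\<^bsub>D\<^esub> B + A \<star>\<^bsub>D\<^esub> C"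
  by (simp add: op_comp_alt fold_deriv_comp_add distrib_left sum.distrib)

lemma op_comp_zero [simp]: "A \<star>\<^bsub>D\<^esub> 0 = 0"
  using op_comp_add_right[of A 0 0] by simp

lemma deriv_comp_op_comp: "deriv_comp D v A \<star>\<^bsub>D\<^esub> B = deriv_comp D v (A \<star>\<^bsub>D\<^esub> B)"
  by (induction A rule: diffop_induct)
    (simp_all add: deriv_comp_single op_comp_add_left op_comp_single deriv_comp_add deriv_comp_func_mult)

lemma fold_deriv_comp_op_comp:
  "fold_mset (deriv_comp D) A \<alpha> \<star>\<^bsub>D\<^esub> B = fold_mset (deriv_comp D) (A \<star>\<^bsub>D\<^esub> B) \<alpha>"
  by (induction \<alpha>) (simp_all add: deriv_comp_op_comp)

text \<open>
  The map \<open>X \<mapsto> X \<circ> C\<close> commutes with composing from the left by any \<open>\<partial>\<^sub>v\<close> or any function, and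
  these generate all operators \<open>A\<close>; so associativity needs no binomial formula for \<open>\<partial>\<^sup>\<alpha>\<close>.
\<close>

lemma op_comp_assoc: "(A \<star>\<^bsub>D\<^esub> B) \<star>\<^bsub>D\<^esub> C = A \<star>\<^bsub>D\<^esub> (B \<star>\<^bsub>D\<^esub> C)"
  by (induction A rule: diffop_induct)
    (simp_all add: op_comp_single func_mult_op_comp fold_deriv_comp_op_comp op_comp_add_left)

lemma op_comp_one: "A \<star>\<^bsub>D\<^esub> func 1 = A"
proof (induction A rule: diffop_induct)
  case (single \<alpha> c)
  have "fold_mset (deriv_comp D) (func 1) \<alpha> = Poly_Mapping.single \<alpha> 1"
    by (induction \<alpha>) (simp_all add: func_def deriv_comp_single)
  then show ?case
    by (simp add: op_comp_single func_mult_single)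
qed (simp add: op_comp_add_left)

lemma op_apply_deriv_comp: "op_apply D (deriv_comp D v A) \<phi> = D v (op_apply D A \<phi>)"
  by (induction A rule: diffop_induct)
    (simp_all add: deriv_comp_single deriv_comp_add op_apply_add op_apply_single deriv_add deriv_mult)

lemma op_apply_op_comp: "op_apply D (A \<star>\<^bsub>D\<^esub> B) \<phi> = op_apply D A (op_apply D B \<phi>)"
proof (induction A rule: diffop_induct)
  case (single \<alpha> c)
  have "op_apply D (fold_mset (deriv_comp D) B \<alpha>) \<phi> = fold_mset D (op_apply D B \<phi>) \<alpha>"
    by (induction \<alpha>) (simp_all add: op_apply_deriv_comp)
  then show ?case
    by (simp add: op_comp_single op_apply_func_mult op_apply_single)
qed (simp add: op_comp_add_left op_apply_add)

lemma op_apply_zero [simp]: "op_apply D A 0 = 0"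
proof -
  have "fold_mset D 0 \<alpha> = 0" for \<alpha>
    by (induction \<alpha>) simp_all
  then show ?thesis
    by (simp add: op_apply_def)
qed

end

section \<open>Principal symbols\<close>

text \<open>
  The leading monomials of two polynomials multiply to a monomial of the product that arises in
  only one way, provided that monomials carry a linear order compatible with their product.  As
  \<open>'v\<close> has no given order, such an order is pulled back along an injective homomorphism \<open>h\<close> from
  the lexicographic order on exponent vectors indexed by \<open>nat\<close>.
\<close>

lemma symbols_no_zero_divisors:
  fixes P Q :: "'v::finite multiset \<Rightarrow>\<^sub>0 'a::semiring_no_zero_divisors"
  assumes "P \<noteq> 0" "Q \<noteq> 0"
  shows "P * Q \<noteq> 0"
proof -
  obtain g :: "'v \<Rightarrow> nat" where g: "inj g"
    using finite_imp_inj_to_nat_seg[OF finite[of "UNIV :: 'v set"]] by auto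
  define h :: "'v multiset \<Rightarrow> (nat \<Rightarrow>\<^sub>0 nat)"
    where "h \<alpha> = (\<Sum>v\<in>#\<alpha>. Poly_Mapping.single (g v) 1)" for \<alpha>
  have h_add: "h (\<alpha> + \<beta>) = h \<alpha> + h \<beta>" for \<alpha> \<beta>
    by (simp add: h_def)
  have lookup_h: "Poly_Mapping.lookup (h \<alpha>) (g v) = count \<alpha> v" for \<alpha> v
    by (induction \<alpha>) (auto simp: h_def lookup_add lookup_single when_def inj_eq[OF g])
  have h_inj: "\<alpha> = \<beta>" if "h \<alpha> = h \<beta>" for \<alpha> \<beta>
    by (rule multiset_eqI) (metis that lookup_h)
  have ex_max: "\<exists>\<alpha>\<in>Poly_Mapping.keys R. \<forall>\<beta>\<in>Poly_Mapping.keys R. h \<beta> \<le> h \<alpha>"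
    if "R \<noteq> 0" for R :: "'v multiset \<Rightarrow>\<^sub>0 'a"
  proof -
    have "Poly_Mapping.keys R \<noteq> {}"
      using that by simp
    then have "Max (h ` Poly_Mapping.keys R) \<in> h ` Poly_Mapping.keys R"
      by simp
    then show ?thesis
      by (metis (no_types, lifting) Max_ge finite_imageI finite_keys imageE image_eqI)
  qed
  obtain \<alpha> where \<alpha>: "\<alpha> \<in> Poly_Mapping.keys P" "\<And>\<beta>. \<beta> \<in> Poly_Mapping.keys P \<Longrightarrow> h \<beta> \<le> h \<alpha>"
    using ex_max[OF assms(1)] by blast
  obtain \<beta> where \<beta>: "\<beta> \<in> Poly_Mapping.keys Q" "\<And>\<gamma>. \<gamma> \<in> Poly_Mapping.keys Q \<Longrightarrow> h \<gamma> \<le> h \<beta>"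
    using ex_max[OF assms(2)] by blast
  \<comment> \<open>In the convolution at \<open>\<alpha> + \<beta>\<close> only the summand \<open>l = \<alpha>\<close> survives.\<close>
  have "Poly_Mapping.lookup P l * Sum_any (\<lambda>q. Poly_Mapping.lookup Q q when \<alpha> + \<beta> = l + q) =
      (Poly_Mapping.lookup P \<alpha> * Poly_Mapping.lookup Q \<beta> when l = \<alpha>)" for l
  proof (cases "l = \<alpha> \<or> l \<notin> Poly_Mapping.keys P")
    case True
    then show ?thesis
      using \<alpha>(1) by (auto simp: in_keys_iff when_def)
  next
    case False
    then have "h l < h \<alpha>"
      using \<alpha>(2)[of l] h_inj by (auto simp: order.strict_iff_order)
    have "(Poly_Mapping.lookup Q q when \<alpha> + \<beta> = l + q) = 0" for q
    proof (rule ccontr)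
      assume "\<not> ?thesis"
      then have q: "\<alpha> + \<beta> = l + q" "q \<in> Poly_Mapping.keys Q"
        by (auto simp: in_keys_iff when_def split: if_splits)
      have "h l + h q < h \<alpha> + h \<beta>"
        using \<open>h l < h \<alpha>\<close> \<beta>(2)[OF q(2)] by (rule add_less_le_mono)
      then show False
        using q(1) by (metis h_add less_irrefl)
    qed
    then show ?thesis
      using False by simp
  qed
  then have "Poly_Mapping.lookup (P * Q) (\<alpha> + \<beta>) = Poly_Mapping.lookup P \<alpha> * Poly_Mapping.lookup Q \<beta>"
    by (simp add: lookup_mult)
  moreover have "\<dots> \<noteq> 0"
    using \<alpha>(1) \<beta>(1) by (simp add: in_keys_iff)
  ultimately show ?thesis
    by auto
qed

text \<open>
  The bound is strict so that the remainder below a leading part of order zero, which must vanish,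
  is covered too; an operator of order at most \<open>n\<close> is described by \<open>order_less (Suc n)\<close>.
\<close>

definition order_less :: "nat \<Rightarrow> ('v, 'a::zero) diffop \<Rightarrow> bool" where
  "order_less n A \<longleftrightarrow> (\<forall>\<alpha>\<in>Poly_Mapping.keys A. size \<alpha> < n)"

definition homogeneous :: "nat \<Rightarrow> ('v, 'a::zero) diffop \<Rightarrow> bool" where
  "homogeneous n A \<longleftrightarrow> (\<forall>\<alpha>\<in>Poly_Mapping.keys A. size \<alpha> = n)"

lemma order_less_zero [simp]: "order_less n 0"
  by (simp add: order_less_def)

lemma order_less_add: "order_less n A \<Longrightarrow> order_less n B \<Longrightarrow> order_less n (A + B)"
  using keys_add[of A B] by (auto simp: order_less_def)

lemma order_less_sum: "(\<And>i. i \<in> I \<Longrightarrow> order_less n (A i)) \<Longrightarrow> order_less n (sum A I)"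
  by (induction I rule: infinite_finite_induct) (auto intro: order_less_add)

lemma order_less_mult:
  assumes "order_less (Suc m) A" "order_less n B"
  shows "order_less (m + n) (A * B)"
  using assms keys_mult[of A B] by (fastforce simp: order_less_def)

lemma homogeneous_mult: "homogeneous m A \<Longrightarrow> homogeneous n B \<Longrightarrow> homogeneous (m + n) (A * B)"
  using keys_mult[of A B] by (fastforce simp: homogeneous_def)

lemma homogeneous_imp_order_less: "homogeneous n A \<Longrightarrow> order_less (Suc n) A"
  by (auto simp: homogeneous_def order_less_def)

lemma order_less_op_order: "order_less (Suc (op_order A)) A"
  by (auto simp: order_less_def op_order_def less_Suc_eq_le)

lemma lookup_symbol:
  fixes A :: "('v, 'a::field) diffop"
  shows
  "Poly_Mapping.lookup (symbol A) \<alpha> = (if size \<alpha> = op_order A then Poly_Mapping.lookup A \<alpha> else 0)"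
  by (auto simp: symbol_def lookup_sum lookup_single when_def sum.delta in_keys_iff)

lemma homogeneous_symbol: "homogeneous (op_order A) (symbol A)"
  by (auto simp: homogeneous_def in_keys_iff lookup_symbol split: if_splits)

lemma order_less_minus_symbol: "order_less (op_order A) (A - symbol A)"
  unfolding order_less_def
proof
  fix \<alpha> assume "\<alpha> \<in> Poly_Mapping.keys (A - symbol A)"
  then have "size \<alpha> \<noteq> op_order A" "\<alpha> \<in> Poly_Mapping.keys A"
    by (auto simp: in_keys_iff lookup_minus lookup_symbol split: if_splits)
  then show "size \<alpha> < op_order A"
    using order_less_op_order[of A] by (fastforce simp: order_less_def)
qed

text \<open>
  A decomposition into a nonzero homogeneous part and a remainder of smaller order determines
  order and symbol; the product rule below is obtained by exhibiting such a decomposition.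
\<close>

lemma symbol_eqI:
  assumes H: "homogeneous n H" "H \<noteq> 0" and R: "order_less n R"
  shows "op_order (H + R) = n" "symbol (H + R) = H"
proof -
  have H_lookup: "Poly_Mapping.lookup H \<alpha> = 0" if "size \<alpha> \<noteq> n" for \<alpha>
    using H(1) that by (auto simp: homogeneous_def in_keys_iff)
  have R_lookup: "Poly_Mapping.lookup R \<alpha> = 0" if "size \<alpha> \<ge> n" for \<alpha>
    using R that by (meson in_keys_iff leD order_less_def)
  obtain \<alpha> where "\<alpha> \<in> Poly_Mapping.keys H"
    using H(2) by fastforce
  then have "size \<alpha> = n" "\<alpha> \<in> Poly_Mapping.keys (H + R)"
    using H(1) R_lookup[of \<alpha>] by (auto simp: homogeneous_def in_keys_iff lookup_add)
  moreover have "size \<beta> \<le> n" if "\<beta> \<in> Poly_Mapping.keys (H + R)" for \<beta>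
    using that H_lookup[of \<beta>] R_lookup[of \<beta>] by (force simp: in_keys_iff lookup_add)
  ultimately show order: "op_order (H + R) = n"
    unfolding op_order_def by (intro Max_eqI) auto
  show "symbol (H + R) = H"
    by (rule poly_mapping_eqI) (auto simp: lookup_symbol order lookup_add R_lookup H_lookup)
qed

lemma symbol_zero [simp]: "symbol 0 = 0"
  by (simp add: symbol_def)

lemma symbol_eq_0_iff [simp]: "symbol A = 0 \<longleftrightarrow> A = 0"
proof
  assume "symbol A = 0"
  show "A = 0"
  proof (rule ccontr)
    assume "A \<noteq> 0"
    have "op_order A \<in> size ` Poly_Mapping.keys A"
    proof -
      have ne: "size ` Poly_Mapping.keys A \<noteq> {}"
        using \<open>A \<noteq> 0\<close> by simp
      then have "op_order A = Max (size ` Poly_Mapping.keys A)"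
        by (simp add: op_order_def)
      then show ?thesis
        using ne by simp
    qed
    then obtain \<alpha> where "\<alpha> \<in> Poly_Mapping.keys A" "size \<alpha> = op_order A"
      by auto
    then show False
      using \<open>symbol A = 0\<close> lookup_symbol[of A \<alpha>] by (simp add: in_keys_iff)
  qed
qed simp

lemma op_order_eq_0_iff: "op_order A = 0 \<longleftrightarrow> A \<in> func_ops"
proof
  assume "op_order A = 0"
  then have "\<alpha> = {#}" if "\<alpha> \<in> Poly_Mapping.keys A" for \<alpha>
    using order_less_op_order[of A] that by (auto simp: order_less_def)
  then have "A = func (Poly_Mapping.lookup A {#})"
    by (intro poly_mapping_eqI) (auto simp: func_def lookup_single when_def in_keys_iff)
  then show "A \<in> func_ops"
    by blast
next
  assume "A \<in> func_ops"
  then show "op_order A = 0"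
    by (auto simp: func_def op_order_def)
qed

lemma symbol_func [simp]: "symbol (func c) = func c"
  by (rule poly_mapping_eqI)
    (auto simp: lookup_symbol func_def lookup_single when_def op_order_def)

lemma op_order_add_less:
  fixes A B :: "('v, 'a::field) diffop"
  assumes "op_order B < op_order A"
  shows "op_order (A + B) = op_order A"
proof -
  have "A \<noteq> 0"
    using assms by (auto simp: op_order_def)
  moreover have "order_less (op_order A) B"
    using order_less_op_order[of B] assms by (auto simp: order_less_def)
  ultimately have "op_order (symbol A + (A - symbol A + B)) = op_order A"
    by (intro symbol_eqI(1)) (auto intro: homogeneous_symbol order_less_minus_symbol order_less_add)
  then show ?thesis
    by (simp add: add.assoc[symmetric])
qed

context differential_field
begin

text \<open>
  The Leibniz rule \<open>\<partial>\<^sub>v b = b \<partial>\<^sub>v + \<partial>\<^sub>v(b)\<close>: moving a derivation past a coefficient costs only a term of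
  smaller order.
\<close>

lemma deriv_comp_eq_mult_plus_lower:
  assumes "order_less n B"
  shows "order_less n (deriv_comp D v B - Poly_Mapping.single {#v#} 1 * B)"
proof -
  have "Poly_Mapping.single {#v#} 1 * B =
      (\<Sum>\<beta>\<in>Poly_Mapping.keys B. Poly_Mapping.single (add_mset v \<beta>) (Poly_Mapping.lookup B \<beta>))"
    by (subst (1) sum_keys_single[of B, symmetric]) (simp add: sum_distrib_left mult_single)
  then have "deriv_comp D v B - Poly_Mapping.single {#v#} 1 * B =
      (\<Sum>\<beta>\<in>Poly_Mapping.keys B. Poly_Mapping.single \<beta> (D v (Poly_Mapping.lookup B \<beta>)))"
    by (simp add: deriv_comp_def sum.distrib)
  also have "order_less n \<dots>"
    using assms by (intro order_less_sum) (auto simp: order_less_def split: if_splits)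
  finally show ?thesis .
qed

lemma fold_deriv_comp_eq_mult_plus_lower:
  assumes "order_less (Suc n) B"
  shows "order_less (size \<alpha> + n) (fold_mset (deriv_comp D) B \<alpha> - Poly_Mapping.single \<alpha> 1 * B)"
proof (induction \<alpha>)
  case empty
  have "Poly_Mapping.single {#} 1 * B = B"
    by (simp flip: zero_multiset_def)
  then show ?case
    by simp
next
  case (add v \<alpha>)
  let ?X = "fold_mset (deriv_comp D) B \<alpha>" and ?v = "Poly_Mapping.single {#v#} (1::'a)"
    and ?\<alpha> = "Poly_Mapping.single \<alpha> (1::'a)"
  have split: "?X = (?X - ?\<alpha> * B) + ?\<alpha> * B"
    by simp
  have v: "order_less (Suc 1) ?v" and \<alpha>: "order_less (Suc (size \<alpha>)) ?\<alpha>"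
    by (auto simp: order_less_def)
  have "order_less (size \<alpha> + Suc n) ?X"
    using order_less_mult[OF \<alpha> assms] add
    by (subst split, intro order_less_add) (auto simp: order_less_def)
  then have "order_less (size \<alpha> + Suc n) (deriv_comp D v ?X - ?v * ?X)"
    by (rule deriv_comp_eq_mult_plus_lower)
  moreover have "order_less (1 + (size \<alpha> + n)) (?v * (?X - ?\<alpha> * B))"
    by (rule order_less_mult[OF v add])
  ultimately have "order_less (size \<alpha> + Suc n) ((deriv_comp D v ?X - ?v * ?X) + ?v * (?X - ?\<alpha> * B))"
    by (intro order_less_add) simp_all
  also have "(deriv_comp D v ?X - ?v * ?X) + ?v * (?X - ?\<alpha> * B) =
      deriv_comp D v ?X - Poly_Mapping.single (add_mset v \<alpha>) 1 * B"
    by (simp add: right_diff_distrib mult_single flip: mult.assoc)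
  finally show ?case
    by simp
qed

text \<open>
  The commutative product \<open>A * B\<close> forgets only derivatives of coefficients, which sit in
  lower order.  This is the link between operators and symbols.
\<close>

lemma op_comp_eq_mult_plus_lower: "order_less (op_order A + op_order B) (A \<star>\<^bsub>D\<^esub> B - A * B)"
proof -
  let ?a = "\<lambda>\<alpha>. func (Poly_Mapping.lookup A \<alpha>)"
  have "A * B = (\<Sum>\<alpha>\<in>Poly_Mapping.keys A. ?a \<alpha> * (Poly_Mapping.single \<alpha> 1 * B))"
    by (subst (1) sum_keys_single[of A, symmetric])
      (simp add: sum_distrib_right func_mult_single flip: mult.assoc)
  then have "A \<star>\<^bsub>D\<^esub> B - A * B =
      (\<Sum>\<alpha>\<in>Poly_Mapping.keys A. ?a \<alpha> * (fold_mset (deriv_comp D) B \<alpha> - Poly_Mapping.single \<alpha> 1 * B))"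
    by (simp add: op_comp_alt sum_subtractf right_diff_distrib)
  also have "order_less (op_order A + op_order B) \<dots>"
  proof (rule order_less_sum)
    fix \<alpha> assume \<alpha>: "\<alpha> \<in> Poly_Mapping.keys A"
    have "order_less (Suc 0) (?a \<alpha>)"
      by (simp add: order_less_def func_def)
    from order_less_mult[OF this fold_deriv_comp_eq_mult_plus_lower[OF order_less_op_order]]
    have "order_less (size \<alpha> + op_order B)
        (?a \<alpha> * (fold_mset (deriv_comp D) B \<alpha> - Poly_Mapping.single \<alpha> 1 * B))"
      by simp
    moreover have "size \<alpha> \<le> op_order A"
      using order_less_op_order[of A] \<alpha> by (auto simp: order_less_def)
    ultimately show "order_less (op_order A + op_order B)
        (?a \<alpha> * (fold_mset (deriv_comp D) B \<alpha> - Poly_Mapping.single \<alpha> 1 * B))"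
      by (force simp: order_less_def)
  qed
  finally show ?thesis .
qed

lemma
  assumes "A \<noteq> 0" "B \<noteq> 0"
  shows op_order_op_comp: "op_order (A \<star>\<^bsub>D\<^esub> B) = op_order A + op_order B"
    and symbol_op_comp_nonzero: "symbol (A \<star>\<^bsub>D\<^esub> B) = symbol A * symbol B"
proof -
  let ?R = "(A \<star>\<^bsub>D\<^esub> B - A * B) + ((A - symbol A) * B + symbol A * (B - symbol B))"
  have split: "A \<star>\<^bsub>D\<^esub> B = symbol A * symbol B + ?R"
    by (simp add: algebra_simps)
  have "order_less (op_order A + op_order B) ((A - symbol A) * B)"
    using order_less_mult[OF order_less_op_order[of B] order_less_minus_symbol[of A]]
    by (simp add: mult.commute add.commute)
  moreover have "order_less (op_order A + op_order B) (symbol A * (B - symbol B))"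
    by (intro order_less_mult homogeneous_imp_order_less homogeneous_symbol order_less_minus_symbol)
  ultimately have R: "order_less (op_order A + op_order B) ?R"
    by (intro order_less_add op_comp_eq_mult_plus_lower)
  have H: "homogeneous (op_order A + op_order B) (symbol A * symbol B)"
    by (intro homogeneous_mult homogeneous_symbol)
  have nz: "symbol A * symbol B \<noteq> 0"
    using assms by (intro symbols_no_zero_divisors) simp_all
  show "op_order (A \<star>\<^bsub>D\<^esub> B) = op_order A + op_order B"
    by (subst split) (rule symbol_eqI(1)[OF H nz R])
  show "symbol (A \<star>\<^bsub>D\<^esub> B) = symbol A * symbol B"
    by (subst split) (rule symbol_eqI(2)[OF H nz R])
qed

lemma symbol_op_comp: "symbol (A \<star>\<^bsub>D\<^esub> B) = symbol A * symbol B"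
  by (cases "A = 0 \<or> B = 0") (auto simp: symbol_op_comp_nonzero)

text \<open>
  Symbols commute and have no zero divisors, so equal symbols cancel although their operators
  stand on opposite sides of the two products.
\<close>

lemma symbol_cancel:
  assumes "N \<star>\<^bsub>D\<^esub> X = Y \<star>\<^bsub>D\<^esub> M" "symbol N = symbol M" "M \<noteq> 0"
  shows "symbol X = symbol Y"
proof -
  have "symbol M * symbol X = symbol Y * symbol M"
    using arg_cong[OF assms(1), of symbol] assms(2) by (simp add: symbol_op_comp)
  then have "symbol M * (symbol X - symbol Y) = 0"
    by (simp add: right_diff_distrib mult.commute)
  then show ?thesis
    using symbols_no_zero_divisors[of "symbol M" "symbol X - symbol Y"] assms(3) by auto
qed

lemma op_comp_eq_func_imp_func:
  assumes "A \<star>\<^bsub>D\<^esub> B = func f" "f \<noteq> 0"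
  shows "B \<in> func_ops"
proof -
  have "A \<noteq> 0" "B \<noteq> 0"
    using assms by auto
  then have "op_order A + op_order B = op_order (func f :: ('v, 'a) diffop)"
    using op_order_op_comp[of A B] assms(1) by simp
  also have "\<dots> = 0"
    by (simp add: op_order_eq_0_iff)
  finally show ?thesis
    by (simp add: op_order_eq_0_iff)
qed

end

section \<open>Division chains and Darboux transformations\<close>

text \<open>
  The recursion runs downward from \<open>k + 1\<close>, but the induction prepends a new term at index \<open>0\<close> and
  shifts the others, which avoids subtraction on indices.
\<close>

lemma exists_backward_recursion:
  "\<exists>N. N (Suc k) = x \<and> N k = y \<and> (\<forall>i<k. N i = g i (N (Suc i)) (N (Suc (Suc i))))"
proof (induction k arbitrary: g)
  case 0
  show ?case
    by (rule exI[of _ "\<lambda>i. if i = 0 then y else x"]) simp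
next
  case (Suc k)
  obtain N where N: "N (Suc k) = x" "N k = y"
      "\<forall>i<k. N i = g (Suc i) (N (Suc i)) (N (Suc (Suc i)))"
    using Suc.IH[of "\<lambda>i. g (Suc i)"] by blast
  show ?case
    using N
    by (intro exI[of _ "case_nat (g 0 (N 0) (N (Suc 0))) N"]) (auto simp: less_Suc_eq_0_disj)
qed

lemma wronskian_snoc_member:
  assumes "\<phi> \<in> set fs"
  shows "wronskian d (fs @ [\<phi>]) = 0"
proof -
  obtain i where i: "i < length fs" "fs ! i = \<phi>"
    using assms by (auto simp: in_set_conv_nth)
  show ?thesis
    unfolding wronskian_def
  proof (rule det_identical_columns)
    show "mat (length (fs @ [\<phi>])) (length (fs @ [\<phi>])) (\<lambda>(i, j). (d ^^ i) ((fs @ [\<phi>]) ! j))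
        \<in> carrier_mat (Suc (length fs)) (Suc (length fs))"
      by simp
    show "i \<noteq> length fs" "i < Suc (length fs)" "length fs < Suc (length fs)"
      using i by simp_all
    show "col (mat (length (fs @ [\<phi>])) (length (fs @ [\<phi>])) (\<lambda>(i, j). (d ^^ i) ((fs @ [\<phi>]) ! j))) i =
        col (mat (length (fs @ [\<phi>])) (length (fs @ [\<phi>])) (\<lambda>(i, j). (d ^^ i) ((fs @ [\<phi>]) ! j))) (length fs)"
      using i by (intro eq_vecI) (auto simp: nth_append)
  qed
qed

context differential_field
begin

lemma lin_indep_hd_nonzero:
  assumes "lin_indep D fs" "fs \<noteq> []"
  shows "hd fs \<noteq> 0"
proof
  assume "hd fs = 0"
  let ?c = "\<lambda>i::nat. if i = 0 then 1 else 0 :: 'a"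
  have "(\<Sum>i<length fs. ?c i * fs ! i) = 0"
    using assms(2) \<open>hd fs = 0\<close> by (intro sum.neutral) (auto simp: hd_conv_nth)
  moreover have "\<forall>i<length fs. ?c i \<in> constants D"
    by (simp add: constants_def)
  ultimately have "\<forall>i<length fs. ?c i = 0"
    using assms(1) unfolding lin_indep_def by (elim allE[of _ ?c]) blast
  then show False
    using assms(2) by auto
qed

text \<open>
  Each remainder is \<open>M\<^sub>i - A\<^sub>i\<^sub>+\<^sub>1 M\<^sub>i\<^sub>+\<^sub>1\<close>, so a left ideal that contains the first two terms of the
  chain contains them all.  Keeping \<open>J\<close> arbitrary lets it be a principal left ideal in one
  application and the annihilator of a function in the other.
\<close>

lemma remainders_in_left_ideal:
  assumes mult: "\<And>C X. X \<in> J \<Longrightarrow> C \<star>\<^bsub>D\<^esub> X \<in> J"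
    and diff: "\<And>X Y. X \<in> J \<Longrightarrow> Y \<in> J \<Longrightarrow> X - Y \<in> J"
    and division: "\<And>i. i < k \<Longrightarrow> M i = A (Suc i) \<star>\<^bsub>D\<^esub> M (Suc i) + M (Suc (Suc i))"
    and start: "M 0 \<in> J" "M 1 \<in> J"
  shows "M (Suc k) \<in> J"
proof -
  have "M i \<in> J \<and> M (Suc i) \<in> J" if "i \<le> k" for i
    using that
  proof (induction i)
    case 0
    show ?case
      using start by simp
  next
    case (Suc i)
    then have i: "M i \<in> J" "M (Suc i) \<in> J" "i < k"
      by simp_all
    have "M (Suc (Suc i)) = M i - A (Suc i) \<star>\<^bsub>D\<^esub> M (Suc i)"
      unfolding division[OF i(3)] by simp
    also have "\<dots> \<in> J"
      by (intro diff mult i)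
    finally show ?case
      using i(2) by blast
  qed
  then show ?thesis
    by simp
qed

text \<open>
  An operator of Wronskian form kills each \<open>f\<^sub>j\<close>, since two columns of the numerator coincide;
  independence gives \<open>f\<^sub>1 \<noteq> 0\<close>.
\<close>

lemma wronskian_form_annihilates:
  assumes "wronskian_form D L M"
  obtains \<phi> where "\<phi> \<noteq> 0" "op_apply D L \<phi> = 0" "op_apply D M \<phi> = 0"
proof -
  obtain E v fs where "change_of_variables D E" "fs \<noteq> []" "set fs \<subseteq> op_ker D L" "lin_indep D fs"
      and M: "\<And>\<phi>. op_apply D M \<phi> = wronskian (E v) (fs @ [\<phi>]) / wronskian (E v) fs"
    using assms unfolding wronskian_form_def by blast
  have "hd fs \<in> set fs"
    using \<open>fs \<noteq> []\<close> by simp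
  show thesis
  proof
    show "hd fs \<noteq> 0"
      by (rule lin_indep_hd_nonzero) fact+
    show "op_apply D L (hd fs) = 0"
      using \<open>hd fs \<in> set fs\<close> \<open>set fs \<subseteq> op_ker D L\<close> by (auto simp: op_ker_def)
    show "op_apply D M (hd fs) = 0"
      using \<open>hd fs \<in> set fs\<close> by (simp add: M wronskian_snoc_member)
  qed
qed

text \<open>
  Downward induction: once \<open>M\<^sub>i\<^sub>+\<^sub>2\<close> has smaller order than \<open>M\<^sub>i\<^sub>+\<^sub>1\<close>, it cannot disturb the leading part of
  \<open>A\<^sub>i\<^sub>+\<^sub>1 M\<^sub>i\<^sub>+\<^sub>1\<close>, whose order exceeds that of \<open>M\<^sub>i\<^sub>+\<^sub>1\<close> because the quotient is not a function.
\<close>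

lemma order_strictly_decreases:
  assumes nonzero: "\<And>i. 1 \<le> i \<Longrightarrow> i \<le> k \<Longrightarrow> A i \<noteq> 0 \<and> M i \<noteq> 0"
    and division: "\<And>i. i < k \<Longrightarrow> M i = A (Suc i) \<star>\<^bsub>D\<^esub> M (Suc i) + M (Suc (Suc i))"
    and quotients: "\<And>i. 2 \<le> i \<Longrightarrow> i \<le> k \<Longrightarrow> A i \<notin> func_ops"
    and last: "op_order (M (Suc k)) < op_order (M k)"
    and "1 \<le> i" "i \<le> k"
  shows "op_order (M (Suc i)) < op_order (M i)"
  using \<open>i \<le> k\<close> \<open>1 \<le> i\<close>
proof (induction i rule: inc_induct)
  case base
  show ?case
    by (rule last)
next
  case (step i)
  then have i: "i < k" "1 \<le> Suc i" "Suc i \<le> k" "2 \<le> Suc i"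
    by simp_all
  let ?P = "A (Suc i) \<star>\<^bsub>D\<^esub> M (Suc i)"
  have IH: "op_order (M (Suc (Suc i))) < op_order (M (Suc i))"
    by (rule step.IH) fact
  have "op_order (A (Suc i)) \<noteq> 0"
    using quotients[OF i(4,3)] by (simp only: op_order_eq_0_iff not_False_eq_True)
  moreover have P: "op_order ?P = op_order (A (Suc i)) + op_order (M (Suc i))"
    using nonzero[OF i(2,3)] by (intro op_order_op_comp) simp_all
  ultimately have less: "op_order (M (Suc i)) < op_order ?P"
    by linarith
  have "op_order (M i) = op_order ?P"
    unfolding division[OF i(1)] by (rule op_order_add_less) (rule less_trans[OF IH less])
  then show ?case
    using less by (simp only:)
qed

end

theorem theorem5p3:
  fixes D :: "'v::finite \<Rightarrow> 'a::field_char_0 \<Rightarrow> 'a"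
    and L :: "('v, 'a) diffop"
    and A M :: "nat \<Rightarrow> ('v, 'a) diffop"
    and f :: 'a
    and k :: nat
  assumes "differential_field D"
    and "1 \<le> k"
    and "\<forall>i\<in>{1..k}. A i \<noteq> 0 \<and> M i \<noteq> 0"
    and "f \<noteq> 0"
    and "M (k + 1) = func f"
    and "M 0 = L"
    and "\<forall>i\<in>{1..k}. M (i - 1) = A i \<star>\<^bsub>D\<^esub> M i + M (i + 1)"
  shows "\<exists>N L1.
     N (k + 1) = func f \<and>
     N k = func f \<star>\<^bsub>D\<^esub> M k \<star>\<^bsub>D\<^esub> func (inverse f) \<and>
     (\<forall>i<k. N i = N (i + 1) \<star>\<^bsub>D\<^esub> A (i + 1) + N (i + 2)) \<and>
     L1 = N 0 \<and>
     darboux D L L1 (M 1) (N 1) \<and>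
     symbol (M 1) = symbol (N 1) \<and>
     N 1 \<star>\<^bsub>D\<^esub> L = L1 \<star>\<^bsub>D\<^esub> M 1 \<and>
     \<not> from_factorization D L L1 (M 1) (N 1) \<and>
     \<not> multiple_of_wronskian_type D L L1 (M 1) (N 1) \<and>
     (1 < k \<and> (\<forall>i\<in>{2..k}. A i \<notin> func_ops) \<and> M k \<notin> func_ops \<longrightarrow>
        \<not> type_I D L L1 (M 1) (N 1))"
proof -
  interpret differential_field D
    by fact
  have M_last: "M (Suc k) = func f"
    using assms(5) by simp
  have division: "M i = A (Suc i) \<star>\<^bsub>D\<^esub> M (Suc i) + M (Suc (Suc i))" if "i < k" for i
    using assms(7)[rule_format, of "Suc i"] that by simp
  have M_nonzero: "M i \<noteq> 0" if "1 \<le> i" "i \<le> Suc k" for i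
    using assms(3,4) M_last that by (cases "i = Suc k") auto
  have L_division: "L = A 1 \<star>\<^bsub>D\<^esub> M 1 + M 2"
    using division[of 0] assms(2,6) by (simp add: numeral_2_eq_2)
  obtain N where N_last: "N (Suc k) = func f"
      and N_k: "N k = func f \<star>\<^bsub>D\<^esub> M k \<star>\<^bsub>D\<^esub> func (inverse f)"
      and N_rec: "\<And>i. i < k \<Longrightarrow> N i = N (Suc i) \<star>\<^bsub>D\<^esub> A (Suc i) + N (Suc (Suc i))"
    using exists_backward_recursion[of k "func f" "func f \<star>\<^bsub>D\<^esub> M k \<star>\<^bsub>D\<^esub> func (inverse f)"
        "\<lambda>i X Y. X \<star>\<^bsub>D\<^esub> A (Suc i) + Y"] by blast

  have intertwining: "N (Suc i) \<star>\<^bsub>D\<^esub> M i = N i \<star>\<^bsub>D\<^esub> M (Suc i)" if "i \<le> k" for i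
    using that
  proof (induction i rule: inc_induct)
    case base
    have "func (inverse f) \<star>\<^bsub>D\<^esub> func f = (func 1 :: ('v, 'a) diffop)"
      using assms(4) by (simp add: func_op_comp flip: func_mult_func)
    then show ?case
      by (simp add: N_last N_k M_last op_comp_assoc op_comp_one)
  next
    case (step i)
    then show ?case
      by (simp add: division[of i] N_rec[of i] op_comp_add_left op_comp_add_right op_comp_assoc)
  qed
  have symbols: "symbol (N i) = symbol (M i)" if "i \<le> Suc k" for i
    using that
  proof (induction i rule: inc_induct)
    case base
    show ?case
      by (simp add: N_last M_last)
  next
    case (step i)
    then show ?case
      using symbol_cancel[of "N (Suc i)" "M i" "N i" "M (Suc i)"] intertwining[of i] M_nonzero[of "Suc i"]
      by simp
  qed
  have intertwining_L: "N 1 \<star>\<^bsub>D\<^esub> L = N 0 \<star>\<^bsub>D\<^esub> M 1"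
    using intertwining[of 0] assms(6) by simp

  have f_in_ideal: "func f \<in> J"
    if "\<And>C X. X \<in> J \<Longrightarrow> C \<star>\<^bsub>D\<^esub> X \<in> J" "\<And>X Y. X \<in> J \<Longrightarrow> Y \<in> J \<Longrightarrow> X - Y \<in> J" "L \<in> J" "M 1 \<in> J"
    for J
  proof -
    have "M (Suc k) \<in> J"
      by (rule remainders_in_left_ideal[of J k M A]) (fact that division | simp add: assms(6) that)+
    then show ?thesis
      by (simp add: M_last)
  qed

  have not_factorization: "\<not> from_factorization D L (N 0) (M 1) (N 1)"
  proof
    assume "from_factorization D L (N 0) (M 1) (N 1)"
    then obtain C where C: "M 1 \<notin> func_ops" "L = C \<star>\<^bsub>D\<^esub> M 1"
      unfolding from_factorization_def by blast
    let ?J = "{X. \<exists>B. X = B \<star>\<^bsub>D\<^esub> M 1}"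
    have "func f \<in> ?J"
    proof (rule f_in_ideal)
      show "B \<star>\<^bsub>D\<^esub> X \<in> ?J" if "X \<in> ?J" for B X
        using that by (auto simp: op_comp_assoc[symmetric])
      show "X - Y \<in> ?J" if "X \<in> ?J" "Y \<in> ?J" for X Y
        using that by (auto simp: op_comp_diff_left[symmetric])
      show "L \<in> ?J"
        using C(2) by blast
      have "M 1 = func 1 \<star>\<^bsub>D\<^esub> M 1"
        by (metis func_op_comp func_one mult_1)
      then show "M 1 \<in> ?J"
        by blast
    qed
    then obtain X where "X \<star>\<^bsub>D\<^esub> M 1 = func f"
      by auto
    then show False
      using op_comp_eq_func_imp_func assms(4) C(1) by blast
  qed

  have not_wronskian: "\<not> multiple_of_wronskian_type D L (N 0) (M 1) (N 1)"
  proof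
    assume "multiple_of_wronskian_type D L (N 0) (M 1) (N 1)"
    then obtain g M' where M': "wronskian_form D L M'" "M 1 = func g \<star>\<^bsub>D\<^esub> M'"
      unfolding multiple_of_wronskian_type_def by blast
    obtain \<phi> where \<phi>: "\<phi> \<noteq> 0" "op_apply D L \<phi> = 0" "op_apply D M' \<phi> = 0"
      using wronskian_form_annihilates[OF M'(1)] by blast
    have "func f \<in> {X. op_apply D X \<phi> = 0}"
      by (rule f_in_ideal) (use \<phi> M'(2) in \<open>simp_all add: op_apply_op_comp op_apply_diff\<close>)
    then show False
      using \<phi>(1) assms(4) by (simp add: op_apply_func)
  qed

  have not_type_I: "\<not> type_I D L (N 0) (M 1) (N 1)"
    if "1 < k" and quotients: "\<forall>i\<in>{2..k}. A i \<notin> func_ops" and "M k \<notin> func_ops"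
  proof
    assume "type_I D L (N 0) (M 1) (N 1)"
    then obtain C h where "L = C \<star>\<^bsub>D\<^esub> M 1 + func h"
      unfolding type_I_def by blast
    then have eq: "M 2 = (C - A 1) \<star>\<^bsub>D\<^esub> M 1 + func h"
      using L_division by (simp add: op_comp_diff_left algebra_simps)
    have "op_order (M (Suc k)) < op_order (M k)"
      using \<open>M k \<notin> func_ops\<close> op_order_eq_0_iff[of "M k"] op_order_eq_0_iff[of "M (Suc k)"]
      by (simp add: M_last)
    then have decreasing: "op_order (M (Suc i)) < op_order (M i)" if "1 \<le> i" "i \<le> k" for i
      using that assms(3) quotients division by (intro order_strictly_decreases[of k A M i]) auto
    have order_21: "op_order (M 2) < op_order (M 1)"
      using decreasing[of 1] \<open>1 < k\<close> by (simp add: numeral_2_eq_2)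
    have order_h: "op_order (func h :: ('v, 'a) diffop) = 0"
      by (simp add: op_order_eq_0_iff)
    \<comment> \<open>\<open>M 2\<close> has order strictly between \<open>0\<close> and that of \<open>M 1\<close>, but by \<open>eq\<close> it is either a function or
      of order at least that of \<open>M 1\<close>.\<close>
    show False
    proof (cases "C - A 1 = 0")
      case True
      then have "op_order (M 2) = 0"
        using eq order_h by simp
      then show False
        using decreasing[of 2] \<open>1 < k\<close> by simp
    next
      case False
      have "op_order ((C - A 1) \<star>\<^bsub>D\<^esub> M 1) = op_order (C - A 1) + op_order (M 1)"
        using False M_nonzero[of 1] by (intro op_order_op_comp) simp_all
      then show False
        using op_order_add_less[of "func h" "(C - A 1) \<star>\<^bsub>D\<^esub> M 1"] eq order_h order_21 by simp
    qed
  qed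

  have "darboux D L (N 0) (M 1) (N 1)"
    using symbols[of 0] intertwining_L assms(6) by (simp add: darboux_def)
  then show ?thesis
    using N_last N_k N_rec symbols[of 1] intertwining_L not_factorization not_wronskian not_type_I
    by (intro exI[of _ N] exI[of _ "N 0"] conjI) simp_all
qed

end
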